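(* Let $1 \le r < a < \infty$, $0 \le p \le r$ and $\sigma > 0$, let $V$ be a real Banach space, and let $A : \ell_r \to V$ be an injective bounded non-compact linear operator with non-closed range such that, for some constants $0 < d_1 \le d_2 < \infty$, $$ d_1 \|u\|_a \le \|Au\|_V \le d_2 \|u\|_a \qquad (u \in \ell_r). $$ For $\alpha > 0$ and $v^\delta \in V$ let $T_\alpha^\delta(u) := \|Au - v^\delta\|_V^\sigma + \alpha\, \mathcal{R}_p(u)$ for $u \in \ell_r$. Then for all $\alpha > 0$ and $v^\delta \in V$ there exists an element $u_\alpha^\delta \in \ell_p$ with $T_\alpha^\delta(u_\alpha^\delta) = \inf_{u \in \ell_r} T_\alpha^\delta(u)$. Moreover, every minimizing sequence $\{u_n\}_{n=1}^\infty \subset \ell_p$, i.e. every sequence with $\lim_{n\to\infty} T_\alpha^\delta(u_n) = T_\alpha^\delta(u_\alpha^\delta)$, has a subsequence $\{u_{n_k}\}_{k=1}^\infty$ that converges strongly in $\ell_r$ as $k \to \infty$ to a minimizer of $T_\alpha^\delta$.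
   Context: All sequences are real and indexed by $k = 1,2,\ldots$. For $0 < s < \infty$, $\|u\|_s := (\sum_{k=1}^\infty |u_k|^s)^{1/s}$ and $\ell_s := \{u = (u_k)_{k\ge1} : \|u\|_s < \infty\}$ (a Banach space for $s \ge 1$, a quasi-normed space for $0<s<1$). For $s = 0$, $\|u\|_0 := \#\{k \in \mathbb{N} : u_k \ne 0\}$ and $\ell_0 := \{u : \|u\|_0 < \infty\}$. The penalty functional is $\mathcal{R}_p(u) := \|u\|_p^p$ for $p > 0$ and $\mathcal{R}_0(u) := \|u\|_0$; it takes the value $+\infty$ for $u \notin \ell_p$, so $T_\alpha^\delta(u)$ is finite if and only if $u \in \ell_p$. *)

theory Defs
  imports "HOL-Analysis.Analysis"
begin

text \<open>
  A real sequence is a function \<^typ>\<open>nat \<Rightarrow> real\<close>; the index set is relabelled from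
  $1, 2, \ldots$ to $0, 1, \ldots$ throughout.
\<close>

definition ell :: "real \<Rightarrow> (nat \<Rightarrow> real) set" where
  "ell s = (if s = 0 then {u. finite {k. u k \<noteq> 0}}
            else {u. summable (\<lambda>k. \<bar>u k\<bar> powr s)})"

text \<open>The real-valued (quasi-)norm below is meaningful only on \<^term>\<open>ell s\<close>.\<close>

definition ell_norm :: "real \<Rightarrow> (nat \<Rightarrow> real) \<Rightarrow> real" where
  "ell_norm s u = (if s = 0 then real (card {k. u k \<noteq> 0})
                   else (\<Sum>k. \<bar>u k\<bar> powr s) powr (1 / s))"

definition penalty :: "real \<Rightarrow> (nat \<Rightarrow> real) \<Rightarrow> ereal" where
  "penalty p u = (if u \<in> ell p
                  then ereal (if p = 0 then ell_norm 0 u else ell_norm p u powr p)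
                  else \<infinity>)"

definition tikhonov ::
  "((nat \<Rightarrow> real) \<Rightarrow> 'v::real_normed_vector) \<Rightarrow> real \<Rightarrow> real \<Rightarrow> real \<Rightarrow> 'v \<Rightarrow> (nat \<Rightarrow> real) \<Rightarrow> ereal"
  where "tikhonov A \<sigma> p \<alpha> v u = ereal (norm (A u - v) powr \<sigma>) + ereal \<alpha> * penalty p u"

text \<open>
  An operator with domain \<^term>\<open>ell r\<close> is a function on all sequences of which only the
  values on \<^term>\<open>ell r\<close> are constrained.
\<close>

definition linear_on_ell :: "real \<Rightarrow> ((nat \<Rightarrow> real) \<Rightarrow> 'v::real_vector) \<Rightarrow> bool" where
  "linear_on_ell r A \<longleftrightarrow>
     (\<forall>u\<in>ell r. \<forall>w\<in>ell r. A (\<lambda>k. u k + w k) = A u + A w) \<and>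
     (\<forall>c. \<forall>u\<in>ell r. A (\<lambda>k. c * u k) = c *\<^sub>R A u)"

definition bounded_on_ell :: "real \<Rightarrow> ((nat \<Rightarrow> real) \<Rightarrow> 'v::real_normed_vector) \<Rightarrow> bool" where
  "bounded_on_ell r A \<longleftrightarrow> (\<exists>C. \<forall>u\<in>ell r. norm (A u) \<le> C * ell_norm r u)"

definition compact_on_ell :: "real \<Rightarrow> ((nat \<Rightarrow> real) \<Rightarrow> 'v::real_normed_vector) \<Rightarrow> bool" where
  "compact_on_ell r A \<longleftrightarrow> compact (closure (A ` {u \<in> ell r. ell_norm r u \<le> 1}))"

text \<open>Convergence in the norm of \<^term>\<open>ell r\<close>, for sequences and limits in \<^term>\<open>ell r\<close>.\<close>

definition converges_in_ell :: "real \<Rightarrow> (nat \<Rightarrow> nat \<Rightarrow> real) \<Rightarrow> (nat \<Rightarrow> real) \<Rightarrow> bool" where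
  "converges_in_ell r U u \<longleftrightarrow>
     (\<forall>n. U n \<in> ell r) \<and> u \<in> ell r \<and>
     (\<lambda>n. ell_norm r (\<lambda>k. U n k - u k)) \<longlonglongrightarrow> 0"

lemma tikhonov_finite_iff:
  assumes "\<alpha> > 0"
  shows "tikhonov A \<sigma> p \<alpha> v u < \<infinity> \<longleftrightarrow> u \<in> ell p"
  using assms by (auto simp: tikhonov_def penalty_def)

end

theory Submission
  imports Defs "HOL-Complex_Analysis.Great_Picard"
begin

text \<open>
  Since \<open>\<bar>x\<bar> powr 0\<close> is the indicator of \<open>x \<noteq> 0\<close>, the penalty is \<open>\<Sum>k. \<bar>u k\<bar> powr p\<close> also for
  \<open>p = 0\<close>. A minimizing sequence is bounded in \<open>ell a\<close>, so a subsequence converges coordinatewise.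
  The penalty is lower semicontinuous under coordinatewise convergence by Fatou's lemma, and the
  residual by a Banach--Saks argument in \<open>ell a\<close>, where \<open>a > 1\<close> is used. Hence the limit is a
  minimizer and the penalties converge to its penalty; so no mass escapes to infinity, which upgrades
  coordinatewise convergence to convergence in \<open>ell r\<close>.
\<close>

section \<open>Sequence spaces and power sums, uniformly in the exponent including 0\<close>

text \<open>At exponent 0 the summands take only the values 0 and 1 (HOL sets
  \<open>0 powr 0 = 0\<close>). Summability makes them tend to 0, so they vanish from some index
  on.\<close>

lemma mem_ell_iff: "u \<in> ell s \<longleftrightarrow> summable (\<lambda>k. \<bar>u k\<bar> powr s)"
proof (cases "s = 0")
  case True
  have "finite {k. u k \<noteq> 0}" if "summable (\<lambda>k. \<bar>u k\<bar> powr 0)"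
  proof -
    have "(\<lambda>k. \<bar>u k\<bar> powr 0) \<longlonglongrightarrow> 0"
      using that by (rule summable_LIMSEQ_zero)
    then have "eventually (\<lambda>k. \<bar>u k\<bar> powr 0 < 1) sequentially"
      by (rule order_tendstoD) simp
    then obtain N where "\<And>k. k \<ge> N \<Longrightarrow> \<bar>u k\<bar> powr 0 < 1"
      by (auto simp: eventually_sequentially)
    then have "{k. u k \<noteq> 0} \<subseteq> {..<N}"
      by (force simp: not_le[symmetric])
    then show ?thesis
      using finite_subset by blast
  qed
  moreover have "summable (\<lambda>k. \<bar>u k\<bar> powr 0)" if "finite {k. u k \<noteq> 0}"
    using that by (intro summable_finite[of "{k. u k \<noteq> 0}"]) auto
  ultimately show ?thesis
    using True by (auto simp: ell_def)
qed (simp add: ell_def)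

text \<open>The power of the (quasi-)norm without its root; this form also counts nonzero entries
  when \<open>s = 0\<close>, and it splits additively into head and tail.\<close>

definition powsum :: "real \<Rightarrow> (nat \<Rightarrow> real) \<Rightarrow> real" where
  "powsum s u = (\<Sum>k. \<bar>u k\<bar> powr s)"

lemma powsum_nonneg:
  assumes "u \<in> ell s"
  shows "0 \<le> powsum s u"
  unfolding powsum_def using assms by (intro suminf_nonneg) (auto simp: mem_ell_iff)

lemma powsum_split:
  assumes "u \<in> ell s"
  shows "powsum s u = (\<Sum>k<K. \<bar>u k\<bar> powr s) + powsum s (\<lambda>k. u (k + K))"
  using suminf_split_initial_segment[of "\<lambda>k. \<bar>u k\<bar> powr s" K] assms
  by (simp add: powsum_def mem_ell_iff)

lemma ell_shift: "(\<lambda>k. u (k + K)) \<in> ell s \<longleftrightarrow> u \<in> ell s"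
  unfolding mem_ell_iff using summable_iff_shift[of "\<lambda>k. \<bar>u k\<bar> powr s" K] by simp

lemma powsum_tail_small:
  assumes "u \<in> ell s" "0 < e"
  obtains K where "powsum s (\<lambda>k. u (k + K)) < e"
  using suminf_exist_split[OF assms(2), of "\<lambda>k. \<bar>u k\<bar> powr s"] assms(1)
  by (auto simp: powsum_def mem_ell_iff abs_less_iff)

lemma term_le_powsum:
  assumes "u \<in> ell s"
  shows "\<bar>u k\<bar> powr s \<le> powsum s u"
  using sum_le_suminf[of "\<lambda>k. \<bar>u k\<bar> powr s" "{k}"] assms
  by (simp add: powsum_def mem_ell_iff)

lemma ell_norm_powr:
  assumes "s > 0" "u \<in> ell s"
  shows "ell_norm s u powr s = powsum s u"
  using assms powsum_nonneg[of u s] by (simp add: ell_norm_def powsum_def powr_powr)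

lemma penalty_eq:
  assumes "0 \<le> p" "u \<in> ell p"
  shows "penalty p u = ereal (powsum p u)"
proof (cases "p = 0")
  case True
  then have fin: "finite {k. u k \<noteq> 0}"
    using assms by (simp add: ell_def)
  have "powsum 0 u = (\<Sum>k\<in>{k. u k \<noteq> 0}. \<bar>u k\<bar> powr 0)"
    unfolding powsum_def by (rule suminf_finite[OF fin]) simp
  also have "\<dots> = (\<Sum>k\<in>{k. u k \<noteq> 0}. 1)"
    by (intro sum.cong) auto
  finally show ?thesis
    using assms True by (simp add: penalty_def ell_norm_def)
next
  case False
  then show ?thesis
    using assms ell_norm_powr[of p u] by (simp add: penalty_def)
qed

section \<open>A weighted quasi-triangle inequality\<close>

text \<open>Whichever of \<open>\<bar>x\<bar>\<close> and \<open>\<eta> * \<bar>y\<bar>\<close> is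
  larger absorbs the other. A small \<eta> brings the weight on \<open>y\<close> close to 1 at the
  cost of a large weight on \<open>x\<close>; \<eta> = 1 gives the crude symmetric version.\<close>

lemma abs_add_powr_le:
  fixes x y :: real
  assumes "0 \<le> s" "0 < \<eta>"
  shows "\<bar>x + y\<bar> powr s \<le> (1 + 1/\<eta>) powr s * \<bar>x\<bar> powr s + (1 + \<eta>) powr s * \<bar>y\<bar> powr s"
proof (cases "\<bar>x\<bar> \<le> \<eta> * \<bar>y\<bar>")
  case True
  then have "\<bar>x + y\<bar> powr s \<le> ((1 + \<eta>) * \<bar>y\<bar>) powr s"
    using assms by (intro powr_mono2) (auto simp: algebra_simps)
  also have "\<dots> = (1 + \<eta>) powr s * \<bar>y\<bar> powr s"
    using assms by (simp add: powr_mult)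
  finally show ?thesis
    by (smt (verit) mult_nonneg_nonneg powr_ge_zero)
next
  case False
  have scaled: "\<eta> * \<bar>x + y\<bar> \<le> \<eta> * \<bar>x\<bar> + \<eta> * \<bar>y\<bar>"
    using mult_left_mono[OF abs_triangle_ineq[of x y], of \<eta>] assms by (simp add: algebra_simps)
  from False have "\<bar>x + y\<bar> powr s \<le> ((1 + 1/\<eta>) * \<bar>x\<bar>) powr s"
    using assms by (intro powr_mono2) (auto simp: field_simps intro: order_trans[OF scaled])
  also have "\<dots> = (1 + 1/\<eta>) powr s * \<bar>x\<bar> powr s"
    using assms by (simp add: powr_mult)
  finally show ?thesis
    by (smt (verit) mult_nonneg_nonneg powr_ge_zero)
qed

lemma
  assumes "0 \<le> s" "0 < \<eta>" "u \<in> ell s" "w \<in> ell s"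
  shows ell_add: "(\<lambda>k. u k + w k) \<in> ell s"
    and powsum_add_le:
      "powsum s (\<lambda>k. u k + w k) \<le> (1 + 1/\<eta>) powr s * powsum s u + (1 + \<eta>) powr s * powsum s w"
proof -
  have *: "summable (\<lambda>k. (1 + 1/\<eta>) powr s * \<bar>u k\<bar> powr s)"
    "summable (\<lambda>k. (1 + \<eta>) powr s * \<bar>w k\<bar> powr s)"
    using assms by (auto simp: mem_ell_iff intro: summable_mult)
  show 1: "(\<lambda>k. u k + w k) \<in> ell s"
    unfolding mem_ell_iff
    by (rule summable_comparison_test'[OF summable_add[OF *], of 0])
      (use abs_add_powr_le[OF assms(1,2)] in auto)
  have "powsum s (\<lambda>k. u k + w k)
      \<le> (\<Sum>k. (1 + 1/\<eta>) powr s * \<bar>u k\<bar> powr s + (1 + \<eta>) powr s * \<bar>w k\<bar> powr s)"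
    unfolding powsum_def
    by (rule suminf_le) (use 1 abs_add_powr_le[OF assms(1,2)] summable_add[OF *] in
        \<open>auto simp: mem_ell_iff\<close>)
  also have "\<dots> = (1 + 1/\<eta>) powr s * powsum s u + (1 + \<eta>) powr s * powsum s w"
    using assms suminf_add[OF *]
    by (simp add: powsum_def mem_ell_iff suminf_mult)
  finally show "powsum s (\<lambda>k. u k + w k)
      \<le> (1 + 1/\<eta>) powr s * powsum s u + (1 + \<eta>) powr s * powsum s w" .
qed

lemma
  shows ell_minus: "(\<lambda>k. - u k) \<in> ell s \<longleftrightarrow> u \<in> ell s"
    and powsum_minus: "powsum s (\<lambda>k. - u k) = powsum s u"
  by (simp_all add: mem_ell_iff powsum_def)

lemma ell_diff:
  assumes "0 \<le> s" "u \<in> ell s" "w \<in> ell s"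
  shows "(\<lambda>k. u k - w k) \<in> ell s"
  using ell_add[of s 1 u "\<lambda>k. - w k"] assms by (simp add: ell_minus)

lemma powsum_diff_le:
  assumes "0 \<le> s" "u \<in> ell s" "w \<in> ell s"
  shows "powsum s (\<lambda>k. u k - w k) \<le> 2 powr s * (powsum s u + powsum s w)"
  using powsum_add_le[of s 1 u "\<lambda>k. - w k"] assms
  by (simp add: ell_minus powsum_minus algebra_simps)

section \<open>Comparison of exponents\<close>

text \<open>Smallness is measured by \<open>\<bar>x\<bar> powr p\<close> instead of
  \<open>\<bar>x\<bar>\<close> so that \<open>p = 0\<close> is covered: there the hypothesis forces
  \<open>x = 0\<close>.\<close>

lemma powr_le_of_powr_less_1:
  fixes x :: real
  assumes "0 \<le> p" "p \<le> r" "\<bar>x\<bar> powr p < 1"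
  shows "\<bar>x\<bar> powr r \<le> \<bar>x\<bar> powr p"
proof (cases "x = 0")
  case False
  then have "\<bar>x\<bar> \<le> 1"
    using assms ge_one_powr_ge_zero[of "\<bar>x\<bar>" p] by fastforce
  then show ?thesis
    using assms by (intro powr_mono') auto
qed simp

lemma ell_mono:
  assumes "0 \<le> p" "p \<le> r" "u \<in> ell p"
  shows "u \<in> ell r"
proof -
  have "(\<lambda>k. \<bar>u k\<bar> powr p) \<longlonglongrightarrow> 0"
    using assms by (auto simp: mem_ell_iff intro: summable_LIMSEQ_zero)
  then have "eventually (\<lambda>k. \<bar>u k\<bar> powr p < 1) sequentially"
    by (rule order_tendstoD) simp
  then have "eventually (\<lambda>k. norm (\<bar>u k\<bar> powr r) \<le> \<bar>u k\<bar> powr p) sequentially"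
    by eventually_elim (use powr_le_of_powr_less_1[OF assms(1,2)] in simp)
  then show ?thesis
    using assms(3) unfolding mem_ell_iff by (rule summable_comparison_test_ev)
qed

text \<open>A total below 1 keeps each term below 1, where raising the exponent can only decrease
  it. Applied to tails, this carries smallness from \<open>p\<close> over to
  \<open>r\<close>.\<close>

lemma powsum_mono_exponent:
  assumes "0 \<le> p" "p \<le> r" "u \<in> ell p" "powsum p u < 1"
  shows "powsum r u \<le> powsum p u"
  unfolding powsum_def
proof (rule suminf_le)
  show "\<bar>u k\<bar> powr r \<le> \<bar>u k\<bar> powr p" for k
    using term_le_powsum[OF assms(3), of k] assms by (intro powr_le_of_powr_less_1) auto
  show "summable (\<lambda>k. \<bar>u k\<bar> powr r)" "summable (\<lambda>k. \<bar>u k\<bar> powr p)"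
    using ell_mono[OF assms(1-3)] assms(3) by (auto simp: mem_ell_iff)
qed

section \<open>Lower semicontinuity under coordinatewise convergence\<close>

text \<open>For \<open>s = 0\<close> the summands are only lower semicontinuous at \<open>0\<close>.\<close>

lemma eventually_powr_gt:
  fixes x :: "nat \<Rightarrow> real"
  assumes "0 \<le> s" "x \<longlonglongrightarrow> l" "c < \<bar>l\<bar> powr s"
  shows "eventually (\<lambda>n. c < \<bar>x n\<bar> powr s) sequentially"
proof (cases "l = 0")
  case True
  then have "c < 0"
    using assms by simp
  then show ?thesis
    by (intro always_eventually) (auto intro: less_le_trans)
next
  case False
  then have "(\<lambda>n. \<bar>x n\<bar> powr s) \<longlonglongrightarrow> \<bar>l\<bar> powr s"
    by (intro tendsto_intros assms) auto
  then show ?thesis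
    using assms(3) by (rule order_tendstoD)
qed

lemma eventually_head_sum_gt:
  fixes U :: "nat \<Rightarrow> nat \<Rightarrow> real"
  assumes "0 \<le> s" "\<And>k. (\<lambda>n. U n k) \<longlonglongrightarrow> u k" "0 < e"
  shows "eventually (\<lambda>n. (\<Sum>k<K. \<bar>u k\<bar> powr s) - e < (\<Sum>k<K. \<bar>U n k\<bar> powr s)) sequentially"
proof -
  \<comment> \<open>The error is shared among \<open>K\<close> coordinates; dividing by
    \<open>K + 1\<close> keeps the total loss strictly below \<open>e\<close>, also when
    \<open>K = 0\<close>.\<close>
  have "eventually (\<lambda>n. \<forall>k\<in>{..<K}. \<bar>u k\<bar> powr s - e / (K + 1) < \<bar>U n k\<bar> powr s) sequentially"
    using assms by (intro eventually_ball_finite ballI eventually_powr_gt) auto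
  then show ?thesis
  proof eventually_elim
    case (elim n)
    have "(\<Sum>k<K. \<bar>u k\<bar> powr s - e / (K + 1)) \<le> (\<Sum>k<K. \<bar>U n k\<bar> powr s)"
      using elim by (intro sum_mono) (auto simp: less_imp_le)
    moreover have "K * (e / (K + 1)) < e"
      using assms by (simp add: field_simps)
    ultimately show ?case
      by (simp add: sum_subtractf)
  qed
qed

text \<open>Fatou's lemma for series: each finite head of \<open>u\<close> is nearly dominated by
  the head of \<open>U n\<close>, hence by its total. Bounding all heads by \<rho> gives membership
  and inequality at once.\<close>

lemma
  assumes "0 \<le> s" "\<And>k. (\<lambda>n. U n k) \<longlonglongrightarrow> u k" "\<And>n. U n \<in> ell s"
    and "(\<lambda>n. powsum s (U n)) \<longlonglongrightarrow> \<rho>"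
  shows ell_coordinatewise_limit: "u \<in> ell s"
    and powsum_coordinatewise_limit_le: "powsum s u \<le> \<rho>"
proof -
  have head: "(\<Sum>k<K. \<bar>u k\<bar> powr s) \<le> \<rho>" for K
  proof (rule field_le_epsilon)
    fix e :: real assume e: "0 < e"
    have "eventually (\<lambda>n. powsum s (U n) < \<rho> + e/2) sequentially"
      using assms(4) by (rule order_tendstoD) (use e in simp)
    moreover have "eventually (\<lambda>n. (\<Sum>k<K. \<bar>u k\<bar> powr s) - e/2 < (\<Sum>k<K. \<bar>U n k\<bar> powr s)) sequentially"
      using e by (intro eventually_head_sum_gt assms) simp
    ultimately have "eventually (\<lambda>n. (\<Sum>k<K. \<bar>u k\<bar> powr s) \<le> \<rho> + e) sequentially"
    proof eventually_elim
      case (elim n)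
      then show ?case
        using powsum_split[OF assms(3), of n K] powsum_nonneg[of "\<lambda>k. U n (k + K)" s]
        assms(3)[of n] by (simp add: ell_shift[of "U n"])
    qed
    then show "(\<Sum>k<K. \<bar>u k\<bar> powr s) \<le> \<rho> + e"
      by simp
  qed
  have *: "summable (\<lambda>k. \<bar>u k\<bar> powr s)"
    using head by (intro bounded_imp_summable[where B = \<rho>])
      (auto simp del: sum.lessThan_Suc simp flip: lessThan_Suc_atMost)
  then show "u \<in> ell s"
    by (simp add: mem_ell_iff)
  show "powsum s u \<le> \<rho>"
    unfolding powsum_def using * head by (rule suminf_le_const)
qed

section \<open>From coordinatewise convergence to norm convergence\<close>

text \<open>The totals converge and the heads cannot lose mass in the limit, so the tails of
  \<open>U n\<close> are eventually small at exponent \<open>p\<close>, and then at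
  \<open>r\<close>. On the remaining finite head, coordinatewise convergence suffices.\<close>

lemma converges_in_ell_if_powsum_converges:
  assumes "0 \<le> p" "p \<le> r" "0 < r" "\<And>k. (\<lambda>n. U n k) \<longlonglongrightarrow> u k"
    and U: "\<And>n. U n \<in> ell p" and u: "u \<in> ell p"
    and lim: "(\<lambda>n. powsum p (U n)) \<longlonglongrightarrow> powsum p u"
  shows "converges_in_ell r U u"
proof -
  have Ur: "U n \<in> ell r" and ur: "u \<in> ell r" for n
    using ell_mono[OF assms(1,2)] U u by auto
  have small: "eventually (\<lambda>n. powsum r (\<lambda>k. U n k - u k) < e) sequentially" if "0 < e" for e
  proof -
    \<comment> \<open>The bound 1/3 keeps tails of size \<open>3 * d\<close> within the range where
      exponents may be raised; the other bound makes \<open>2 powr r * (4 * d)\<close> at most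
      \<open>e/2\<close>.\<close>
    define d where "d = min (1/3) (e / (2 powr r * 8))"
    have d: "0 < d" "3 * d \<le> 1" "8 * (2 powr r * d) \<le> e"
      using that by (auto simp: d_def min_def field_simps)
    obtain K where K: "powsum p (\<lambda>k. u (k + K)) < d"
      using powsum_tail_small[OF u d(1)] .
    have "eventually (\<lambda>n. powsum p (U n) < powsum p u + d) sequentially"
      using lim by (rule order_tendstoD) (use d in simp)
    moreover have "eventually (\<lambda>n. (\<Sum>k<K. \<bar>u k\<bar> powr p) - d < (\<Sum>k<K. \<bar>U n k\<bar> powr p)) sequentially"
      using d by (intro eventually_head_sum_gt assms)
    moreover have "(\<lambda>n. \<Sum>k<K. \<bar>U n k - u k\<bar> powr r) \<longlonglongrightarrow> (\<Sum>k<K. \<bar>u k - u k\<bar> powr r)"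
      using assms(3) by (intro tendsto_sum tendsto_powr' tendsto_intros assms(4)) auto
    then have "eventually (\<lambda>n. (\<Sum>k<K. \<bar>U n k - u k\<bar> powr r) < e/2) sequentially"
      by (rule order_tendstoD) (use that in simp)
    ultimately show ?thesis
    proof eventually_elim
      case (elim n)
      \<comment> \<open>Total minus head: one \<open>d\<close> is lost in the total, one in the
        head, and the tail of \<open>u\<close> is below the third.\<close>
      have "powsum p (\<lambda>k. U n (k + K)) < 3 * d"
        using elim(1,2) K powsum_split[OF U, of n K] powsum_split[OF u, of K] by simp
      then have "powsum r (\<lambda>k. U n (k + K)) < 3 * d"
        using powsum_mono_exponent[OF assms(1,2), of "\<lambda>k. U n (k + K)"] U[of n] d
        by (simp add: ell_shift[of "U n"])
      moreover have "powsum r (\<lambda>k. u (k + K)) < d"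
        using powsum_mono_exponent[OF assms(1,2), of "\<lambda>k. u (k + K)"] u d K
        by (simp add: ell_shift)
      ultimately have "powsum r (\<lambda>k. U n (k + K)) + powsum r (\<lambda>k. u (k + K)) \<le> 4 * d"
        by simp
      then have "2 powr r * (powsum r (\<lambda>k. U n (k + K)) + powsum r (\<lambda>k. u (k + K))) \<le> 2 powr r * (4 * d)"
        by (rule mult_left_mono) simp
      also have "\<dots> \<le> e/2"
        using d(3) by simp
      finally have "powsum r (\<lambda>k. U n (k + K) - u (k + K)) \<le> e/2"
        using powsum_diff_le[of r "\<lambda>k. U n (k + K)" "\<lambda>k. u (k + K)"] assms(3) Ur[of n] ur
        by (simp add: ell_shift ell_shift[of "U n"] del: distrib_left_numeral)
      moreover have "(\<lambda>k. U n k - u k) \<in> ell r"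
        using assms(3) Ur ur by (intro ell_diff) auto
      ultimately show ?case
        using elim(3) powsum_split[of "\<lambda>k. U n k - u k" r K] by simp
    qed
  qed
  have nonneg: "0 \<le> powsum r (\<lambda>k. U n k - u k)" for n
    using assms(3) Ur ur by (intro powsum_nonneg ell_diff) auto
  have "(\<lambda>n. powsum r (\<lambda>k. U n k - u k)) \<longlonglongrightarrow> 0"
  proof (rule order_tendstoI)
    show "eventually (\<lambda>n. y < powsum r (\<lambda>k. U n k - u k)) sequentially" if "y < 0" for y
      using that nonneg by (intro always_eventually) (auto intro: less_le_trans)
  qed (rule small)
  then have "(\<lambda>n. powsum r (\<lambda>k. U n k - u k) powr (1/r)) \<longlonglongrightarrow> 0 powr (1/r)"
    using assms(3) nonneg by (intro tendsto_powr' tendsto_intros) auto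
  then show ?thesis
    using assms(3) Ur ur by (simp add: converges_in_ell_def ell_norm_def powsum_def)
qed

section \<open>Asymptotic additivity of power sums and the residual term\<close>

text \<open>A fixed \<open>u\<close> and a coordinatewise null sequence have asymptotically disjoint
  supports: \<open>W n\<close> fades on the head that carries most of \<open>u\<close>, and beyond
  it \<open>u\<close> is small. The slack 1 is spent in three thirds: on the weight of
  \<open>W n\<close>, on the tail of \<open>u\<close>, and on the head.\<close>

lemma eventually_powsum_add_le:
  assumes "0 < s" "u \<in> ell s" "\<And>n. W n \<in> ell s" "\<And>k. (\<lambda>n. W n k) \<longlonglongrightarrow> 0"
    and C: "\<And>n. powsum s (W n) \<le> C"
  shows "eventually (\<lambda>n. powsum s (\<lambda>k. u k + W n k) \<le> powsum s u + C + 1) sequentially"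
proof -
  have C0: "0 \<le> C"
    using C[of 0] powsum_nonneg[OF assms(3), of 0] by simp
  \<comment> \<open>The weight on \<open>W n\<close> tends to 1 as \<eta> decreases to 0, so some
    positive \<eta> costs less than 1/3.\<close>
  have "((\<lambda>\<eta>. (1 + \<eta>) powr s * C) \<longlongrightarrow> (1 + 0) powr s * C) (at_right 0)"
    by (intro tendsto_intros) auto
  then have "eventually (\<lambda>\<eta>. (1 + \<eta>) powr s * C < C + 1/3) (at_right 0)"
    by (rule order_tendstoD) simp
  then have "eventually (\<lambda>\<eta>. (1 + \<eta>) powr s * C < C + 1/3 \<and> \<eta> > 0) (at_right 0)"
    using eventually_at_right_less[of 0] by (rule eventually_conj)
  then have "\<exists>\<eta>. (1 + \<eta>) powr s * C < C + 1/3 \<and> \<eta> > 0"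
    by (rule eventually_happens'[OF trivial_limit_at_right_real])
  then obtain \<eta> :: real where \<eta>: "(1 + \<eta>) powr s * C < C + 1/3" "\<eta> > 0"
    by blast
  define B where "B = (1 + 1/\<eta>) powr s"
  have "1 + 1/\<eta> > 0"
    using \<eta> by (simp add: add_pos_pos)
  then have B: "B > 0"
    by (simp add: B_def)
  \<comment> \<open>With \<eta> fixed, the possibly huge weight \<open>B\<close> on \<open>u\<close>
    is offset by a tail short of \<open>1 / (3 * B)\<close>.\<close>
  obtain K where K: "powsum s (\<lambda>k. u (k + K)) < 1 / (3 * B)"
    using powsum_tail_small[OF assms(2), of "1 / (3 * B)"] B by auto
  have "(\<lambda>n. \<Sum>k<K. \<bar>u k + W n k\<bar> powr s) \<longlonglongrightarrow> (\<Sum>k<K. \<bar>u k + 0\<bar> powr s)"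
    using assms(1) by (intro tendsto_sum tendsto_powr' tendsto_intros assms(4)) auto
  then have "eventually (\<lambda>n. (\<Sum>k<K. \<bar>u k + W n k\<bar> powr s) < (\<Sum>k<K. \<bar>u k\<bar> powr s) + 1/3) sequentially"
    by (rule order_tendstoD) simp
  then show ?thesis
  proof eventually_elim
    case (elim n)
    have "powsum s (\<lambda>k. u (k + K) + W n (k + K))
        \<le> B * powsum s (\<lambda>k. u (k + K)) + (1 + \<eta>) powr s * powsum s (\<lambda>k. W n (k + K))"
      unfolding B_def using assms(1,2) assms(3)[of n] \<eta>
      by (intro powsum_add_le) (auto simp: ell_shift ell_shift[of "W n"])
    moreover have "powsum s (\<lambda>k. W n (k + K)) \<le> powsum s (W n)"
      using powsum_split[OF assms(3), of n K] by (simp add: sum_nonneg)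
    then have "powsum s (\<lambda>k. W n (k + K)) \<le> C"
      using C[of n] by simp
    then have "(1 + \<eta>) powr s * powsum s (\<lambda>k. W n (k + K)) \<le> (1 + \<eta>) powr s * C"
      by (intro mult_left_mono) auto
    moreover have "B * powsum s (\<lambda>k. u (k + K)) < 1/3"
      using K B by (simp add: field_simps)
    moreover have "(\<lambda>k. u k + W n k) \<in> ell s"
      using assms(1-3) by (intro ell_add[of s 1]) auto
    ultimately show ?case
      using elim \<eta>(1) powsum_split[of "\<lambda>k. u k + W n k" s K] powsum_split[OF assms(2), of K]
        powsum_nonneg[of "\<lambda>k. u (k + K)" s] assms(2) by (simp add: ell_shift)
  qed
qed

text \<open>A Banach--Saks argument replaces weak compactness: sums of \<open>m\<close> suitably chosen members of a
  bounded coordinatewise null sequence have norm \<open>O(m powr (1/a))\<close>, so their means tend to \<open>0\<close>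
  because \<open>a > 1\<close>.\<close>

lemma norm_residual_lsc:
  fixes A :: "(nat \<Rightarrow> real) \<Rightarrow> 'v::real_normed_vector"
  assumes r: "0 \<le> r" "r \<le> a" "1 < a" and lin: "linear_on_ell r A"
    and bd: "\<And>u. u \<in> ell r \<Longrightarrow> norm (A u) \<le> d * ell_norm a u" and d: "0 \<le> d"
    and U: "\<And>n. U n \<in> ell r" and u: "u \<in> ell r" and lim: "\<And>k. (\<lambda>n. U n k) \<longlonglongrightarrow> u k"
    and C: "\<And>n. powsum a (U n) \<le> C"
    and L: "(\<lambda>n. norm (A (U n) - v)) \<longlonglongrightarrow> L"
  shows "norm (A u - v) \<le> L"
proof (rule field_le_epsilon)
  fix e :: real assume e: "0 < e"
  have add: "A (\<lambda>k. x k + y k) = A x + A y" if "x \<in> ell r" "y \<in> ell r" for x y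
    using lin that by (simp add: linear_on_ell_def)
  define W where "W n = (\<lambda>k. U n k - u k)" for n
  have W: "W n \<in> ell r" for n
    unfolding W_def using r(1) U u by (intro ell_diff)
  have in_a: "x \<in> ell a" if "x \<in> ell r" for x
    using ell_mono[OF r(1,2) that] .
  have AU: "A (U n) = A (W n) + A u" for n
    using add[OF W u, of n] by (simp add: W_def)
  define D where "D = 2 powr a * (C + powsum a u)"
  have D: "powsum a (W n) \<le> D" for n
  proof -
    have "powsum a (W n) \<le> 2 powr a * (powsum a (U n) + powsum a u)"
      unfolding W_def using r in_a U u by (intro powsum_diff_le) auto
    also have "\<dots> \<le> D"
      unfolding D_def using C[of n] by (intro mult_left_mono) auto
    finally show ?thesis .
  qed
  have D0: "0 \<le> D"
    using D[of 0] powsum_nonneg[OF in_a[OF W], of 0] by simp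
  have evL: "eventually (\<lambda>n. norm (A (U n) - v) < L + e) sequentially"
    using L by (rule order_tendstoD) (use e in simp)
  have lim0: "(\<lambda>n. W n k) \<longlonglongrightarrow> 0" for k
    unfolding W_def using tendsto_diff[OF lim[of k] tendsto_const[of "u k"]] by simp
  \<comment> \<open>\<open>S\<close> is a sum of \<open>m\<close> members of \<open>W\<close>,
    chosen greedily, so \<open>A S + real m *\<^sub>R (A u - v)\<close> is the sum of the
    corresponding residuals \<open>A (U n) - v\<close>, each below \<open>L + e\<close>. Every new
    member is taken late enough to add at most \<open>D + 1\<close> to the power sum.\<close>
  have ex: "\<exists>S\<in>ell r. norm (A S + real m *\<^sub>R (A u - v)) \<le> real m * (L + e) \<and>
      powsum a S \<le> real m * (D + 1)" for m
  proof (induction m)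
    case 0
    \<comment> \<open>Additivity at zero forces \<open>A\<close> to vanish there.\<close>
    have "A (\<lambda>k. 0 + 0) = A (\<lambda>k. 0) + A (\<lambda>k. 0)"
      by (rule add) (simp_all add: mem_ell_iff)
    then show ?case
      by (intro bexI[of _ "\<lambda>k. 0"]) (auto simp: mem_ell_iff powsum_def)
  next
    case (Suc m)
    then obtain S where S: "S \<in> ell r" "norm (A S + real m *\<^sub>R (A u - v)) \<le> real m * (L + e)"
      "powsum a S \<le> real m * (D + 1)"
      by blast
    have "eventually (\<lambda>n. powsum a (\<lambda>k. S k + W n k) \<le> powsum a S + D + 1) sequentially"
      using r in_a S(1) W lim0 D by (intro eventually_powsum_add_le) auto
    then have "eventually (\<lambda>n. powsum a (\<lambda>k. S k + W n k) \<le> powsum a S + D + 1 \<and>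
        norm (A (U n) - v) < L + e) sequentially"
      using evL by (rule eventually_conj)
    from eventually_happens'[OF sequentially_bot this]
    obtain n where n: "powsum a (\<lambda>k. S k + W n k) \<le> powsum a S + D + 1"
      "norm (A (U n) - v) < L + e"
      by blast
    have "A (\<lambda>k. S k + W n k) + real (Suc m) *\<^sub>R (A u - v)
        = (A S + real m *\<^sub>R (A u - v)) + (A (U n) - v)"
      by (simp add: add[OF S(1) W] AU algebra_simps)
    then have "norm (A (\<lambda>k. S k + W n k) + real (Suc m) *\<^sub>R (A u - v))
        \<le> norm (A S + real m *\<^sub>R (A u - v)) + norm (A (U n) - v)"
      by (metis norm_triangle_ineq)
    also have "\<dots> \<le> real m * (L + e) + (L + e)"
      using S(2) n(2) by simp
    also have "\<dots> = real (Suc m) * (L + e)"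
      by (simp add: algebra_simps)
    finally have "norm (A (\<lambda>k. S k + W n k) + real (Suc m) *\<^sub>R (A u - v)) \<le> real (Suc m) * (L + e)" .
    moreover have "(\<lambda>k. S k + W n k) \<in> ell r"
      using r(1) S(1) W by (intro ell_add[of r 1]) auto
    moreover have "powsum a (\<lambda>k. S k + W n k) \<le> real (Suc m) * (D + 1)"
      using n(1) S(3) by (simp add: algebra_simps)
    ultimately show ?case
      by blast
  qed
  \<comment> \<open>After division by \<open>m\<close>, the mean residual contributes
    \<open>L + e\<close>; the rest is \<open>norm (A S) / m\<close>, of order
    \<open>m powr (1/a - 1)\<close> by the upper estimate.\<close>
  have bound: "norm (A u - v) \<le> (L + e) + d * (D + 1) powr (1/a) * real m powr (1/a - 1)"
    if m: "m > 0" for m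
  proof -
    obtain S where S: "S \<in> ell r" "norm (A S + real m *\<^sub>R (A u - v)) \<le> real m * (L + e)"
      "powsum a S \<le> real m * (D + 1)"
      using ex by blast
    have "norm (A S) \<le> d * powsum a S powr (1/a)"
      using bd[OF S(1)] r by (simp add: ell_norm_def powsum_def)
    also have "\<dots> \<le> d * (real m * (D + 1)) powr (1/a)"
      using S(3) d r powsum_nonneg[OF in_a[OF S(1)]] by (intro mult_left_mono powr_mono2) auto
    also have "\<dots> = real m * (d * (D + 1) powr (1/a) * real m powr (1/a - 1))"
      using m D0 by (simp add: powr_mult powr_diff)
    finally have AS: "norm (A S) \<le> real m * (d * (D + 1) powr (1/a) * real m powr (1/a - 1))" .
    have "real m * norm (A u - v) = norm (A S + real m *\<^sub>R (A u - v) - A S)"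
      by simp
    also have "\<dots> \<le> norm (A S + real m *\<^sub>R (A u - v)) + norm (A S)"
      by (rule norm_triangle_ineq4)
    finally have "real m * norm (A u - v)
        \<le> real m * ((L + e) + d * (D + 1) powr (1/a) * real m powr (1/a - 1))"
      using S(2) AS by (simp only: distrib_left)
    then show ?thesis
      using m by simp
  qed
  \<comment> \<open>The exponent \<open>1/a - 1\<close> is negative because
    \<open>1 < a\<close>.\<close>
  have "(\<lambda>m. (L + e) + d * (D + 1) powr (1/a) * real m powr (1/a - 1))
      \<longlonglongrightarrow> (L + e) + d * (D + 1) powr (1/a) * 0"
    using r by (intro tendsto_intros tendsto_neg_powr filterlim_real_sequentially) auto
  then show "norm (A u - v) \<le> L + e"
    using bound by (intro LIMSEQ_le_const) (auto intro!: exI[of _ 1])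
qed

section \<open>Compactness of minimizing sequences\<close>

text \<open>Serves both claims of the theorem: existence, through one constructed minimizing
  sequence, and subconvergence of an arbitrary one. Both terms of the functional are lower
  semicontinuous, and minimality of \<open>m\<close> forbids either to drop in the limit.\<close>

lemma minimizing_sequence_subconverges:
  fixes A :: "(nat \<Rightarrow> real) \<Rightarrow> 'v::real_normed_vector"
  assumes p: "0 \<le> p" "p \<le> r" and r: "1 \<le> r" "r < a" and \<sigma>: "0 < \<sigma>" and \<alpha>: "0 < \<alpha>"
    and lin: "linear_on_ell r A" and d1: "0 < d1" and d2: "0 \<le> d2"
    and lower: "\<And>u. u \<in> ell r \<Longrightarrow> d1 * ell_norm a u \<le> norm (A u)"
    and upper: "\<And>u. u \<in> ell r \<Longrightarrow> norm (A u) \<le> d2 * ell_norm a u"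
    and U: "\<And>n. U n \<in> ell p"
    and lim: "(\<lambda>n. norm (A (U n) - v) powr \<sigma> + \<alpha> * powsum p (U n)) \<longlonglongrightarrow> m"
    and m: "\<And>u. u \<in> ell p \<Longrightarrow> m \<le> norm (A u - v) powr \<sigma> + \<alpha> * powsum p u"
  shows "\<exists>\<phi> u. strict_mono \<phi> \<and> converges_in_ell r (U \<circ> \<phi>) u \<and> u \<in> ell p \<and>
    norm (A u - v) powr \<sigma> + \<alpha> * powsum p u = m"
proof -
  define F where "F u = norm (A u - v) powr \<sigma>" for u
  have F0: "0 \<le> F u" for u
    by (simp add: F_def)
  have Ur: "U n \<in> ell r" for n
    using ell_mono[OF p U] .
  have Ua: "U n \<in> ell a" for n
    using ell_mono[of r a, OF _ _ Ur] r by simp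
  have "Bseq (\<lambda>n. F (U n) + \<alpha> * powsum p (U n))"
    using lim unfolding F_def by (intro convergent_imp_Bseq convergentI)
  then obtain M where M: "\<And>n. \<bar>F (U n) + \<alpha> * powsum p (U n)\<bar> \<le> M"
    by (auto simp: Bseq_def)
  have \<alpha>R: "0 \<le> \<alpha> * powsum p (U n)" for n
    using \<alpha> powsum_nonneg[OF U, of n] by simp
  have FM: "F (U n) \<le> M" and RM: "powsum p (U n) \<le> M / \<alpha>" for n
    using M[of n] F0[of "U n"] \<alpha>R[of n] \<alpha> by (auto simp: field_simps)
  \<comment> \<open>A residual of at most \<open>M powr (1/\<sigma>)\<close> bounds
    \<open>norm (A (U n))\<close> by the triangle inequality; the lower estimate with
    \<open>d1\<close> turns this into a bound in \<open>ell a\<close>.\<close>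
  define B where "B = (norm v + M powr (1/\<sigma>)) / d1"
  have norm_U: "ell_norm a (U n) \<le> B" for n
  proof -
    have "norm (A (U n) - v) = F (U n) powr (1/\<sigma>)"
      using \<sigma> by (simp add: F_def powr_powr)
    also have "\<dots> \<le> M powr (1/\<sigma>)"
      using FM F0 \<sigma> by (intro powr_mono2) auto
    finally have "norm (A (U n)) \<le> norm v + M powr (1/\<sigma>)"
      using norm_triangle_sub[of "A (U n)" v] by simp
    then show ?thesis
      using lower[OF Ur, of n] d1 by (simp add: B_def field_simps)
  qed
  have powsum_U: "powsum a (U n) \<le> B powr a" for n
  proof -
    have "ell_norm a (U n) powr a \<le> B powr a"
      using norm_U r by (intro powr_mono2) (auto simp: ell_norm_def)
    then show ?thesis
      using r Ua by (simp add: ell_norm_powr)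
  qed
  have coord: "norm (U n k) \<le> B" for n k
  proof -
    have "(\<bar>U n k\<bar> powr a) powr (1/a) \<le> powsum a (U n) powr (1/a)"
      using term_le_powsum[OF Ua] r by (intro powr_mono2) auto
    also have "\<dots> = ell_norm a (U n)"
      using r by (simp add: ell_norm_def powsum_def)
    finally show ?thesis
      using norm_U[of n] r by (simp add: powr_powr)
  qed
  \<comment> \<open>Diagonal extraction over the countably many uniformly bounded
    coordinates.\<close>
  obtain \<phi>1 where \<phi>1: "strict_mono \<phi>1" "\<And>k. \<exists>l. (\<lambda>n. U (\<phi>1 n) k) \<longlonglongrightarrow> l"
    using function_convergent_subsequence[of UNIV U B] coord by auto
  then obtain u where u: "\<And>k. (\<lambda>n. U (\<phi>1 n) k) \<longlonglongrightarrow> u k"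
    by metis
  \<comment> \<open>A further extraction makes the penalties converge; the residual terms then
    converge too, as differences from the convergent functional values.\<close>
  have "bounded (range (\<lambda>n. powsum p (U (\<phi>1 n))))"
    using RM powsum_nonneg[OF U] by (intro boundedI[where B = "M / \<alpha>"]) auto
  then obtain \<rho> \<phi>2 where \<phi>2: "strict_mono \<phi>2" "((\<lambda>n. powsum p (U (\<phi>1 n))) \<circ> \<phi>2) \<longlonglongrightarrow> \<rho>"
    using bounded_imp_convergent_subsequence by blast
  define \<phi> where "\<phi> = \<phi>1 \<circ> \<phi>2"
  have \<phi>: "strict_mono \<phi>"
    unfolding \<phi>_def using \<phi>1(1) \<phi>2(1) by (rule strict_mono_o)
  have lim_u: "(\<lambda>n. U (\<phi> n) k) \<longlonglongrightarrow> u k" for k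
    using LIMSEQ_subseq_LIMSEQ[OF u \<phi>2(1)] by (simp add: \<phi>_def o_def)
  have lim_R: "(\<lambda>n. powsum p (U (\<phi> n))) \<longlonglongrightarrow> \<rho>"
    using \<phi>2(2) by (simp add: \<phi>_def o_def)
  have "(\<lambda>n. F (U (\<phi> n)) + \<alpha> * powsum p (U (\<phi> n))) \<longlonglongrightarrow> m"
    using LIMSEQ_subseq_LIMSEQ[OF lim \<phi>] by (simp add: F_def o_def)
  from tendsto_diff[OF this tendsto_mult_left[OF lim_R, of \<alpha>]]
  have lim_F: "(\<lambda>n. F (U (\<phi> n))) \<longlonglongrightarrow> m - \<alpha> * \<rho>"
    by simp
  have f0: "0 \<le> m - \<alpha> * \<rho>"
    using lim_F F0 by (intro LIMSEQ_le_const) auto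
  have "(\<lambda>n. F (U (\<phi> n)) powr (1/\<sigma>)) \<longlonglongrightarrow> (m - \<alpha> * \<rho>) powr (1/\<sigma>)"
    using lim_F \<sigma> F0 by (intro tendsto_powr' tendsto_const) auto
  then have lim_norm: "(\<lambda>n. norm (A (U (\<phi> n)) - v)) \<longlonglongrightarrow> (m - \<alpha> * \<rho>) powr (1/\<sigma>)"
    using \<sigma> by (simp add: F_def powr_powr)
  have up: "u \<in> ell p" and Ru: "powsum p u \<le> \<rho>"
    using ell_coordinatewise_limit[OF p(1) lim_u U lim_R]
      powsum_coordinatewise_limit_le[OF p(1) lim_u U lim_R] .
  have "norm (A u - v) \<le> (m - \<alpha> * \<rho>) powr (1/\<sigma>)"
    using norm_residual_lsc[of r a A d2 "\<lambda>n. U (\<phi> n)", OF _ _ _ lin upper d2 Ur ell_mono[OF p up]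
        lim_u powsum_U lim_norm] r by simp
  then have "F u \<le> ((m - \<alpha> * \<rho>) powr (1/\<sigma>)) powr \<sigma>"
    unfolding F_def using \<sigma> by (intro powr_mono2) auto
  then have Fu: "F u \<le> m - \<alpha> * \<rho>"
    using \<sigma> f0 by (simp add: powr_powr)
  have "m \<le> F u + \<alpha> * powsum p u"
    using m[OF up] by (simp add: F_def)
  \<comment> \<open>Since the residual term is at most \<open>m - \<alpha> * \<rho>\<close>, a
    penalty below \<rho> would push the functional under its lower bound \<open>m\<close>.\<close>
  then have "\<alpha> * \<rho> \<le> \<alpha> * powsum p u"
    using Fu by simp
  then have R_eq: "powsum p u = \<rho>"
    using \<alpha> Ru by simp
  then have "converges_in_ell r (\<lambda>n. U (\<phi> n)) u"
    using r lim_R by (intro converges_in_ell_if_powsum_converges[OF p _ lim_u U up]) auto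
  moreover have "F u + \<alpha> * powsum p u = m"
    using \<open>m \<le> F u + \<alpha> * powsum p u\<close> Fu R_eq by simp
  ultimately show ?thesis
    using \<phi> up by (auto simp: F_def o_def)
qed

section \<open>Transfer to the extended-real functional\<close>

lemma tikhonov_eq:
  assumes "0 \<le> p" "u \<in> ell p"
  shows "tikhonov A \<sigma> p \<alpha> v u = ereal (norm (A u - v) powr \<sigma> + \<alpha> * powsum p u)"
  by (simp add: tikhonov_def penalty_eq[OF assms])

theorem proposition5:
  fixes r a p \<sigma> d1 d2 :: real
    and A :: "(nat \<Rightarrow> real) \<Rightarrow> 'v::banach"
  assumes "1 \<le> r" and "r < a"
    and "0 \<le> p" and "p \<le> r"
    and "\<sigma> > 0"
    and "linear_on_ell r A"
    and "bounded_on_ell r A"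
    and "inj_on A (ell r)"
    and "\<not> compact_on_ell r A"
    and "\<not> closed (A ` ell r)"
    and "0 < d1" and "d1 \<le> d2"
    and "\<And>u. u \<in> ell r \<Longrightarrow>
           d1 * ell_norm a u \<le> norm (A u) \<and> norm (A u) \<le> d2 * ell_norm a u"
  shows "\<forall>\<alpha>>0. \<forall>v\<delta>.
    \<exists>u\<alpha>\<delta>\<in>ell p.
      tikhonov A \<sigma> p \<alpha> v\<delta> u\<alpha>\<delta> = (INF u\<in>ell r. tikhonov A \<sigma> p \<alpha> v\<delta> u) \<and>
      (\<forall>U. (\<forall>n. U n \<in> ell p) \<and>
           (\<lambda>n. tikhonov A \<sigma> p \<alpha> v\<delta> (U n)) \<longlonglongrightarrow> tikhonov A \<sigma> p \<alpha> v\<delta> u\<alpha>\<delta> \<longrightarrow>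
           (\<exists>\<phi> u. strict_mono \<phi> \<and> converges_in_ell r (U \<circ> \<phi>) u \<and>
                  tikhonov A \<sigma> p \<alpha> v\<delta> u = (INF w\<in>ell r. tikhonov A \<sigma> p \<alpha> v\<delta> w)))"
proof (intro allI impI)
  fix \<alpha> :: real and v\<delta> :: 'v
  assume \<alpha>: "0 < \<alpha>"
  define J where "J u = norm (A u - v\<delta>) powr \<sigma> + \<alpha> * powsum p u" for u
  define I where "I = (INF u\<in>ell r. tikhonov A \<sigma> p \<alpha> v\<delta> u)"
  have T: "tikhonov A \<sigma> p \<alpha> v\<delta> u = ereal (J u)" if "u \<in> ell p" for u
    using tikhonov_eq[OF assms(3) that] by (simp add: J_def)
  have I_le: "I \<le> ereal (J u)" if "u \<in> ell p" for u
    using INF_lower[OF ell_mono[OF assms(3,4) that], of "tikhonov A \<sigma> p \<alpha> v\<delta>"] T[OF that]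
    by (simp add: I_def)
  \<comment> \<open>Outside \<open>ell p\<close> the value is infinite. The infimum thus lies
    between 0 and the finite value at the zero sequence, so it is a real number.\<close>
  have "0 \<le> tikhonov A \<sigma> p \<alpha> v\<delta> u" for u
    using T[of u] tikhonov_finite_iff[OF \<alpha>, of A \<sigma> p v\<delta> u] \<alpha> powsum_nonneg[of u p]
    by (cases "u \<in> ell p") (auto simp: J_def)
  then have "0 \<le> I"
    unfolding I_def by (intro INF_greatest)
  moreover have "(\<lambda>k. 0) \<in> ell p"
    by (simp add: mem_ell_iff)
  ultimately obtain m where m: "I = ereal m"
    using I_le[of "\<lambda>k. 0"] by (cases I) auto
  have subconv: "\<exists>\<phi> u. strict_mono \<phi> \<and> converges_in_ell r (U \<circ> \<phi>) u \<and> u \<in> ell p \<and>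
      tikhonov A \<sigma> p \<alpha> v\<delta> u = I"
    if U: "\<And>n. U n \<in> ell p" and lim: "(\<lambda>n. tikhonov A \<sigma> p \<alpha> v\<delta> (U n)) \<longlonglongrightarrow> I" for U
  proof -
    have "\<exists>\<phi> u. strict_mono \<phi> \<and> converges_in_ell r (U \<circ> \<phi>) u \<and> u \<in> ell p \<and>
        norm (A u - v\<delta>) powr \<sigma> + \<alpha> * powsum p u = m"
    proof (rule minimizing_sequence_subconverges[where a = a and ?d1.0 = d1 and ?d2.0 = d2])
      show "(\<lambda>n. norm (A (U n) - v\<delta>) powr \<sigma> + \<alpha> * powsum p (U n)) \<longlonglongrightarrow> m"
        using lim by (simp add: T[OF U] m J_def)
      show "m \<le> norm (A u - v\<delta>) powr \<sigma> + \<alpha> * powsum p u" if "u \<in> ell p" for u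
        using I_le[OF that] by (simp add: m J_def)
    qed (use assms \<alpha> U in auto)
    then show ?thesis
      using T by (metis J_def m)
  qed
  \<comment> \<open>Near-minimizers are drawn from \<open>ell r\<close>, but their finite value
    places them in \<open>ell p\<close>; the margins \<open>inverse (real (Suc n))\<close> make them
    a minimizing sequence.\<close>
  have "\<exists>w\<in>ell p. J w < m + inverse (real (Suc n))" for n
  proof -
    have "I < ereal (m + inverse (real (Suc n)))"
      by (simp add: m)
    then obtain w where "w \<in> ell r" and less: "tikhonov A \<sigma> p \<alpha> v\<delta> w < ereal (m + inverse (real (Suc n)))"
      by (auto simp: I_def INF_less_iff)
    moreover have "w \<in> ell p"
      using less tikhonov_finite_iff[OF \<alpha>, of A \<sigma> p v\<delta> w] by (auto intro: less_trans)
    ultimately show ?thesis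
      using T by (intro bexI[of _ w]) auto
  qed
  then obtain W where W: "\<And>n. W n \<in> ell p" "\<And>n. J (W n) < m + inverse (real (Suc n))"
    by metis
  have "(\<lambda>n. J (W n)) \<longlonglongrightarrow> m"
  proof (rule tendsto_sandwich)
    show "eventually (\<lambda>n. m \<le> J (W n)) sequentially"
      using I_le[OF W(1)] by (simp add: m)
    show "eventually (\<lambda>n. J (W n) \<le> m + inverse (real (Suc n))) sequentially"
      using W(2) by (auto intro: less_imp_le always_eventually)
    show "(\<lambda>n. m + inverse (real (Suc n))) \<longlonglongrightarrow> m"
      using tendsto_add[OF tendsto_const LIMSEQ_inverse_real_of_nat] by simp
  qed (rule tendsto_const)
  then have "(\<lambda>n. tikhonov A \<sigma> p \<alpha> v\<delta> (W n)) \<longlonglongrightarrow> I"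
    by (simp add: T[OF W(1)] m)
  then obtain u where u: "u \<in> ell p" "tikhonov A \<sigma> p \<alpha> v\<delta> u = I"
    using subconv W(1) by blast
  show "\<exists>u\<alpha>\<delta>\<in>ell p.
      tikhonov A \<sigma> p \<alpha> v\<delta> u\<alpha>\<delta> = (INF u\<in>ell r. tikhonov A \<sigma> p \<alpha> v\<delta> u) \<and>
      (\<forall>U. (\<forall>n. U n \<in> ell p) \<and>
           (\<lambda>n. tikhonov A \<sigma> p \<alpha> v\<delta> (U n)) \<longlonglongrightarrow> tikhonov A \<sigma> p \<alpha> v\<delta> u\<alpha>\<delta> \<longrightarrow>
           (\<exists>\<phi> u. strict_mono \<phi> \<and> converges_in_ell r (U \<circ> \<phi>) u \<and>
                  tikhonov A \<sigma> p \<alpha> v\<delta> u = (INF w\<in>ell r. tikhonov A \<sigma> p \<alpha> v\<delta> w)))"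
    unfolding I_def[symmetric] using u subconv by (intro bexI[of _ u]) (auto, blast)
qed

end
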